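(* For every odd $n\in\mathbb{N}$, there exist a cost-sensitive classification (CSC) problem with two actions ($A=2$) and a single context ($|\mathcal{X}|=1$), and a realizable function class $\mathcal{F}$ (that is, $\bar C\in\mathcal{F}$) with $|\mathcal{F}|=2$, such that: (a) $\sigma^2(\pi^\star)=0$, i.e. the cost of the optimal policy has zero variance; but (b) the greedy policy $\pi_{\hat f^{\mathrm{bce}}_{\mathcal{F}}}$ induced by the empirical binary-cross-entropy risk minimizer $\hat f^{\mathrm{bce}}_{\mathcal{F}}$ computed from $n$ i.i.d. samples satisfies, with probability at least $\tfrac14$, $$V(\pi_{\hat f^{\mathrm{bce}}_{\mathcal{F}}})-V^\star\ \ge\ \frac{1}{8\sqrt{n}}.$$
   Context: A CSC problem consists of a context space $\mathcal{X}$, a finite number of actions $A$ (with action set $\mathcal{A}=\{1,\dots,A\}$), and a distribution $d$ on $\mathcal{X}\times[0,1]^A$; a draw is $(x,c(1),\dots,c(A))\sim d$. For a policy $\pi:\mathcal{X}\to\{1,\dots,A\}$, $V(\pi)=\mathbb{E}[c(\pi(x))]$, $V^\star=\min_\pi V(\pi)$, and $\pi^\star$ is an optimal policy. $\bar C(x,a)=\mathbb{E}[c(a)\mid x]$ is the conditional mean cost. With a single context, $\sigma^2(\pi)$ is the variance of the cost $c(\pi(x))$. The data are $n$ i.i.d. draws $(x_i,c_i(1),\dots,c_i(A))\sim d$. A function class $\mathcal{F}$ is a set of functions $\mathcal{X}\times\mathcal{A}\to[0,1]$. The binary-cross-entropy loss is $\ell_{\mathrm{bce}}(\hat y,y)=-y\ln\hat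 y-(1-y)\ln(1-\hat y)$, with the convention $0\ln 0=0$. The estimator is $$\hat f^{\mathrm{bce}}_{\mathcal{F}}\in\operatorname*{argmin}_{f\in\mathcal{F}}\sum_{i=1}^n\sum_{a=1}^A\ell_{\mathrm{bce}}(f(x_i,a),c_i(a)).$$ For $f:\mathcal{X}\times\mathcal{A}\to[0,1]$, the induced greedy policy is $\pi_f(x)\in\operatorname{argmin}_a f(x,a)$. *)

theory Defs
  imports "HOL-Probability.Probability"
begin

text \<open>
  The sigma-algebra on the context space is carried by the measure \<open>X\<close>, of which only
  \<open>space X\<close> and \<open>sets X\<close> are used.  A draw is a pair \<open>z\<close> with context \<open>fst z\<close> and cost vector
  \<open>snd z\<close>, where \<open>snd z a\<close> is the cost of action \<open>a\<close>.
\<close>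

definition csc_problem ::
    "'x measure \<Rightarrow> nat \<Rightarrow> ('x \<times> (nat \<Rightarrow> real)) measure \<Rightarrow> bool" where
  "csc_problem X A d \<longleftrightarrow>
     prob_space d \<and>
     sets d = sets (X \<Otimes>\<^sub>M (\<Pi>\<^sub>M a\<in>{1..A}. restrict_space borel {0..1}))"

definition policies :: "'x measure \<Rightarrow> nat \<Rightarrow> ('x \<Rightarrow> nat) set" where
  "policies X A = measurable X (count_space {1..A})"

definition policy_value ::
    "('x \<times> (nat \<Rightarrow> real)) measure \<Rightarrow> ('x \<Rightarrow> nat) \<Rightarrow> real" where
  "policy_value d \<pi> = (\<integral>z. snd z (\<pi> (fst z)) \<partial>d)"

definition optimal_value ::
    "'x measure \<Rightarrow> nat \<Rightarrow> ('x \<times> (nat \<Rightarrow> real)) measure \<Rightarrow> real" where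
  "optimal_value X A d = (INF \<pi>\<in>policies X A. policy_value d \<pi>)"

definition optimal_policy ::
    "'x measure \<Rightarrow> nat \<Rightarrow> ('x \<times> (nat \<Rightarrow> real)) measure \<Rightarrow> ('x \<Rightarrow> nat) \<Rightarrow> bool" where
  "optimal_policy X A d = is_arg_min (policy_value d) (\<lambda>\<pi>. \<pi> \<in> policies X A)"

definition policy_variance ::
    "('x \<times> (nat \<Rightarrow> real)) measure \<Rightarrow> ('x \<Rightarrow> nat) \<Rightarrow> real" where
  "policy_variance d \<pi> = (\<integral>z. (snd z (\<pi> (fst z)) - policy_value d \<pi>)\<^sup>2 \<partial>d)"

text \<open>
  Functions are extensional, so that equality in a function class, and hence its cardinality,
  only depends on the values on the domain.
\<close>

definition function_class :: "'x measure \<Rightarrow> nat \<Rightarrow> ('x \<times> nat \<Rightarrow> real) set \<Rightarrow> bool" where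
  "function_class X A F \<longleftrightarrow> F \<subseteq> (space X \<times> {1..A}) \<rightarrow>\<^sub>E {0..1}"

text \<open>
  \<open>f (x, a)\<close> is a version of the conditional expectation of the cost of \<open>a\<close> given the context:
  the conditioning sigma-algebra is the one generated by the projection to the context.
\<close>

definition conditional_mean_cost ::
    "'x measure \<Rightarrow> nat \<Rightarrow> ('x \<times> (nat \<Rightarrow> real)) measure \<Rightarrow> ('x \<times> nat \<Rightarrow> real) \<Rightarrow> bool" where
  "conditional_mean_cost X A d f \<longleftrightarrow>
     (\<forall>a\<in>{1..A}.
        (\<lambda>x. f (x, a)) \<in> borel_measurable X \<and>
        (AE z in d. real_cond_exp d (vimage_algebra (space d) fst X) (\<lambda>z. snd z a) z
                      = f (fst z, a)))"

definition realizable ::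
    "'x measure \<Rightarrow> nat \<Rightarrow> ('x \<times> (nat \<Rightarrow> real)) measure \<Rightarrow> ('x \<times> nat \<Rightarrow> real) set \<Rightarrow> bool" where
  "realizable X A d F \<longleftrightarrow> (\<exists>f\<in>F. conditional_mean_cost X A d f)"

text \<open>
  The loss is infinite when a prediction of 0 or 1 is refuted, whereas \<open>ln 0 = 0\<close> holds for the
  real logarithm; hence extended reals.  There \<open>0 * \<infinity> = 0\<close>, which is the convention
  \<open>0 ln 0 = 0\<close>.
\<close>

definition neg_ln :: "real \<Rightarrow> ereal" where
  "neg_ln p = (if p = 0 then \<infinity> else ereal (- ln p))"

definition bce_loss :: "real \<Rightarrow> real \<Rightarrow> ereal" where
  "bce_loss yhat y = ereal y * neg_ln yhat + ereal (1 - y) * neg_ln (1 - yhat)"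

definition bce_risk ::
    "nat \<Rightarrow> nat \<Rightarrow> (nat \<Rightarrow> 'x \<times> (nat \<Rightarrow> real)) \<Rightarrow> ('x \<times> nat \<Rightarrow> real) \<Rightarrow> ereal" where
  "bce_risk A n S f = (\<Sum>i=1..n. \<Sum>a=1..A. bce_loss (f (fst (S i), a)) (snd (S i) a))"

definition bce_minimizer ::
    "nat \<Rightarrow> nat \<Rightarrow> ('x \<times> nat \<Rightarrow> real) set \<Rightarrow> (nat \<Rightarrow> 'x \<times> (nat \<Rightarrow> real)) \<Rightarrow>
     ('x \<times> nat \<Rightarrow> real) \<Rightarrow> bool" where
  "bce_minimizer A n F S = is_arg_min (bce_risk A n S) (\<lambda>f. f \<in> F)"

definition greedy_policy ::
    "'x measure \<Rightarrow> nat \<Rightarrow> ('x \<times> nat \<Rightarrow> real) \<Rightarrow> ('x \<Rightarrow> nat) \<Rightarrow> bool" where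
  "greedy_policy X A f \<pi> \<longleftrightarrow>
     \<pi> \<in> policies X A \<and>
     (\<forall>x\<in>space X. is_arg_min (\<lambda>a. f (x, a)) (\<lambda>a. a \<in> {1..A}) (\<pi> x))"

definition iid_sample :: "nat \<Rightarrow> 'z measure \<Rightarrow> (nat \<Rightarrow> 'z) measure" where
  "iid_sample n d = (\<Pi>\<^sub>M i\<in>{1..n}. d)"

end

theory Submission
  imports Defs
begin

text \<open>
  Action 1 always costs 1/2 and action 2 costs a coin flip with mean \<open>p = 1/2 + e\<close>, where
  \<open>e = 1 / (8 * sqrt n)\<close>.  The class consists of the truth \<open>(1/2, p)\<close> and its mirror image
  \<open>(1/2, 1 - p)\<close>, so the empirical risk minimizer picks the wrong one as soon as fewer than half
  of the \<open>n\<close> flips are 1; there are no ties on the coin sample as \<open>n\<close> is odd.  If \<open>P\<close> is the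
  probability of this event, Cauchy--Schwarz over the pairs of outcomes with \<open>k\<close> and \<open>n - k\<close> ones
  gives \<open>P * (1 - P) \<ge> (4 * p * (1 - p)) ^ n / 4 = (1 - 4 * e ^ 2) ^ n / 4\<close>, which by Bernoulli's
  inequality is at least 15/64; hence \<open>P \<ge> 3/8\<close>.
\<close>

section \<open>The lower half of a binomial distribution\<close>

lemma binomial_pmf_lower_half_mult_upper_half:
  fixes p :: real
  assumes "0 \<le> p" "p \<le> 1" and n: "n = 2 * m + 1"
  defines "P \<equiv> measure_pmf.prob (binomial_pmf n p) {..m}"
  shows "(4 * p * (1 - p)) ^ n / 4 \<le> P * (1 - P)"
proof -
  define q where "q = 1 - p"
  have q: "0 \<le> q" by (simp add: q_def assms)
  have pm: "pmf (binomial_pmf n p) k = (n choose k) * p ^ k * q ^ (n - k)" for k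
    using assms by (simp add: q_def)
  \<comment> \<open>\<open>a k\<close> and \<open>b k\<close> are square roots of the probabilities
    of \<open>k\<close> and \<open>n - k\<close> ones, so in \<open>a k * b k\<close> the powers of
    \<open>p\<close> and \<open>q\<close> pair up to a factor that does not depend on
    \<open>k\<close>.\<close>
  define a where "a k = sqrt ((n choose k) * p ^ k * q ^ (n - k))" for k
  define b where "b k = sqrt ((n choose k) * p ^ (n - k) * q ^ k)" for k
  have a: "(\<Sum>k\<le>m. (a k)\<^sup>2) = P"
    unfolding P_def a_def using assms(1,2) q
    by (subst measure_measure_pmf_finite) (auto intro!: sum.cong simp: pm simp del: pmf_binomial)
  have "1 - P = measure_pmf.prob (binomial_pmf n p) {Suc m..n}"
  proof -
    have "1 - P = measure_pmf.prob (binomial_pmf n p) (UNIV - {..m})"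
      unfolding P_def by (subst measure_pmf.prob_compl[symmetric]) auto
    \<comment> \<open>The two sets differ only beyond \<open>n\<close>, outside the support.\<close>
    also have "\<dots> = measure_pmf.prob (binomial_pmf n p) {Suc m..n}"
      using assms(1,2)
      by (intro measure_pmf.finite_measure_eq_AE)
         (auto simp: AE_measure_pmf_iff set_pmf_binomial_eq split: if_splits)
    finally show ?thesis .
  qed
  also have "\<dots> = (\<Sum>k=Suc m..n. (n choose k) * p ^ k * q ^ (n - k))"
    by (subst measure_measure_pmf_finite) (auto simp: pm simp del: pmf_binomial)
  \<comment> \<open>As \<open>n\<close> is odd, \<open>k \<mapsto> n - k\<close> exchanges the two
    halves and leaves no middle term.\<close>
  also have "\<dots> = (\<Sum>k\<le>m. (n choose k) * p ^ (n - k) * q ^ k)"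
    by (rule sum.reindex_bij_witness[where i = "\<lambda>k. n - k" and j = "\<lambda>k. n - k"])
       (auto simp: n binomial_symmetric[symmetric])
  also have "\<dots> = (\<Sum>k\<le>m. (b k)\<^sup>2)"
    unfolding b_def using assms(1,2) q by (intro sum.cong) auto
  finally have b: "(\<Sum>k\<le>m. (b k)\<^sup>2) = 1 - P" by simp
  have ab: "a k * b k = (n choose k) * sqrt ((p * q) ^ n)" if "k \<le> m" for k
  proof -
    have kn: "n = k + (n - k)" using that n by simp
    have "a k * b k = sqrt ((n choose k)\<^sup>2 * ((p ^ k * p ^ (n - k)) * (q ^ k * q ^ (n - k))))"
      by (simp add: a_def b_def real_sqrt_mult[symmetric] power2_eq_square mult_ac)
    also have "\<dots> = sqrt ((n choose k)\<^sup>2 * (p * q) ^ n)"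
      by (simp add: power_add[symmetric] kn[symmetric] power_mult_distrib)
    also have "\<dots> = (n choose k) * sqrt ((p * q) ^ n)"
      by (simp add: real_sqrt_mult)
    finally show ?thesis .
  qed
  have "(\<Sum>k\<le>m. a k * b k) = real (\<Sum>k\<le>m. n choose k) * sqrt ((p * q) ^ n)"
    by (simp add: ab sum_distrib_right)
  \<comment> \<open>The lower half of an odd row of Pascal's triangle sums to half of
    \<open>2 ^ n\<close>, which is \<open>4 ^ m\<close>.\<close>
  also have "\<dots> = 4 ^ m * sqrt ((p * q) ^ n)"
    by (simp only: n binomial_r_part_sum) (simp add: power_mult)
  finally have "(4 ^ m * sqrt ((p * q) ^ n))\<^sup>2 \<le> P * (1 - P)"
    using Cauchy_Schwarz_ineq_sum[of a b "{..m}"] by (simp add: a b)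
  also have "(4 ^ m * sqrt ((p * q) ^ n))\<^sup>2 = (4 * p * q) ^ n / 4"
    using assms(1) q
    by (simp add: power_mult_distrib n power_mult[symmetric] mult.commute)
  finally show ?thesis by (simp add: q_def)
qed

lemma binomial_pmf_lower_half_ge:
  assumes n: "n = 2 * m + 1"
  shows "3 / 8 \<le> measure_pmf.prob (binomial_pmf n (1 / 2 + 1 / (8 * sqrt (real n)))) {..m}"
    (is "_ \<le> ?P")
proof -
  define e where "e = 1 / (8 * sqrt (real n))"
  have "1 \<le> sqrt (real n)" using n by simp
  then have e: "0 < e" "e \<le> 1 / 8" by (auto simp: e_def field_simps)
  \<comment> \<open>The root in \<open>e\<close> cancels \<open>n\<close>, so Bernoulli's bound is
    15/16 for every \<open>n\<close>.\<close>
  have e2: "4 * real n * e\<^sup>2 = 1 / 16" using n by (simp add: e_def power2_eq_square field_simps)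
  have "e\<^sup>2 \<le> (1 / 8)\<^sup>2" using e by (intro power_mono) auto
  then have "1 + real n * (- 4 * e\<^sup>2) \<le> (1 + (- 4 * e\<^sup>2)) ^ n"
    by (intro Bernoulli_inequality) (auto simp: power2_eq_square)
  also have "1 + (- 4 * e\<^sup>2) = 4 * (1 / 2 + e) * (1 - (1 / 2 + e))"
    by (simp add: algebra_simps power2_eq_square)
  also have "1 + real n * (- 4 * e\<^sup>2) = 15 / 16" using e2 by simp
  finally have "15 / 64 \<le> ?P * (1 - ?P)"
    using binomial_pmf_lower_half_mult_upper_half[OF _ _ n, of "1 / 2 + e"] e
    unfolding e_def[symmetric] by simp
  \<comment> \<open>Since 15/64 is the product of 3/8 and 5/8, which sum to 1, the quadratic factors
    and \<open>?P\<close> lies between them.\<close>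
  then have "(?P - 3 / 8) * (5 / 8 - ?P) \<ge> 0" by (simp add: algebra_simps)
  then show ?thesis
    unfolding zero_le_mult_iff by linarith
qed

section \<open>Finite products of image measures of pmfs\<close>

text \<open>Both measures give a box the product of the probabilities of the preimages of its sides,
  and boxes determine a finite product measure. This turns a sample from image measures into an
  image of independent discrete draws.\<close>

lemma PiM_distr_measure_pmf:
  fixes p :: "'i \<Rightarrow> 'b pmf"
  assumes A: "finite A" and f: "\<And>i. i \<in> A \<Longrightarrow> range (f i) \<subseteq> space (M i)"
  shows "(\<Pi>\<^sub>M i\<in>A. distr (measure_pmf (p i)) (M i) (f i)) =
    distr (measure_pmf (Pi_pmf A dflt p)) (Pi\<^sub>M A M) (\<lambda>b. \<lambda>i\<in>A. f i (b i))"
proof -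
  \<comment> \<open>The locale \<open>product_prob_space\<close> demands a probability measure at
    every index; outside \<open>A\<close>, where nothing is known of \<open>M\<close> and
    \<open>f\<close>, a point mass at \<open>undefined\<close> is put in.\<close>
  define M' where "M' i = (if i \<in> A then M i else return (count_space UNIV) undefined)" for i
  define f' where "f' i = (if i \<in> A then f i else (\<lambda>_. undefined))" for i
  define D where "D i = distr (measure_pmf (p i)) (M' i) (f' i)" for i
  have f'[measurable]: "f' i \<in> measurable (measure_pmf (p i)) (M' i)" for i
    using f by (auto simp: f'_def M'_def)
  have D: "prob_space (D i)" for i
    unfolding D_def by (intro prob_space.prob_space_distr f') (rule prob_space_measure_pmf)
  then interpret product_prob_space D
    by (rule product_prob_spaceI)
  have M: "Pi\<^sub>M A M = Pi\<^sub>M A M'" by (intro PiM_cong) (auto simp: M'_def)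
  have F: "(\<lambda>b. \<lambda>i\<in>A. f i (b i)) \<in> measurable (measure_pmf (Pi_pmf A dflt p)) (Pi\<^sub>M A M)"
    using f by (auto simp: space_PiM image_subset_iff)
  have "distr (measure_pmf (Pi_pmf A dflt p)) (Pi\<^sub>M A M) (\<lambda>b. \<lambda>i\<in>A. f i (b i)) = Pi\<^sub>M A D"
  proof (rule PiM_eqI[OF A])
    show "sets (distr (measure_pmf (Pi_pmf A dflt p)) (Pi\<^sub>M A M) (\<lambda>b. \<lambda>i\<in>A. f i (b i))) = sets (Pi\<^sub>M A D)"
      by (simp add: M D_def cong: sets_PiM_cong)
  next
    fix B assume B: "\<And>i. i \<in> A \<Longrightarrow> B i \<in> sets (D i)"
    then have "Pi\<^sub>E A B \<in> sets (Pi\<^sub>M A M)"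
      unfolding M by (intro sets_PiM_I_finite A) (auto simp: D_def)
    \<comment> \<open>Restriction to \<open>A\<close> makes the image extensional, so the preimage
      of the extensional box is an ordinary \<open>Pi\<close> set, whose probability under
      \<open>Pi_pmf\<close> factorizes.\<close>
    then have "emeasure (distr (measure_pmf (Pi_pmf A dflt p)) (Pi\<^sub>M A M) (\<lambda>b. \<lambda>i\<in>A. f i (b i))) (Pi\<^sub>E A B)
      = emeasure (measure_pmf (Pi_pmf A dflt p)) (Pi A (\<lambda>i. f i -` B i))"
      by (subst emeasure_distr[OF F]) (auto intro!: arg_cong2[where f = emeasure])
    also have "\<dots> = (\<Prod>i\<in>A. emeasure (measure_pmf (p i)) (f i -` B i))"
      by (simp add: measure_pmf.emeasure_eq_measure measure_Pi_pmf_Pi[OF A] prod_ennreal)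
    also have "\<dots> = (\<Prod>i\<in>A. emeasure (D i) (B i))"
    proof (intro prod.cong refl)
      fix i assume i: "i \<in> A"
      show "emeasure (measure_pmf (p i)) (f i -` B i) = emeasure (D i) (B i)"
        using B[OF i] i unfolding D_def by (subst emeasure_distr[OF f']) (auto simp: f'_def)
    qed
    finally show "emeasure (distr (measure_pmf (Pi_pmf A dflt p)) (Pi\<^sub>M A M) (\<lambda>b. \<lambda>i\<in>A. f i (b i))) (Pi\<^sub>E A B)
      = (\<Prod>i\<in>A. emeasure (D i) (B i))" .
  qed
  moreover have "(\<Pi>\<^sub>M i\<in>A. distr (measure_pmf (p i)) (M i) (f i)) = Pi\<^sub>M A D"
    by (intro PiM_cong) (auto simp: D_def M'_def f'_def)
  ultimately show ?thesis by simp
qed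

section \<open>The coin problem and its conditional means\<close>

text \<open>The type of contexts is arbitrary, so \<open>undefined\<close> serves as the single
  context.\<close>

definition coin_context :: "'x measure" where
  "coin_context = count_space {undefined}"

text \<open>Restriction to \<open>{1..2}\<close> makes the cost vector extensional, as points of the
  product space are.\<close>

definition coin_draw :: "bool \<Rightarrow> 'x \<times> (nat \<Rightarrow> real)" where
  "coin_draw b = (undefined, \<lambda>a\<in>{1..2}. if a = 1 then 1 / 2 else of_bool b)"

definition coin_space :: "('x \<times> (nat \<Rightarrow> real)) measure" where
  "coin_space = coin_context \<Otimes>\<^sub>M (\<Pi>\<^sub>M a\<in>{1..2}. restrict_space borel {0..1})"

definition coin_csc :: "real \<Rightarrow> ('x \<times> (nat \<Rightarrow> real)) measure" where
  "coin_csc p = distr (measure_pmf (bernoulli_pmf p)) coin_space coin_draw"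

definition coin_predictor :: "real \<Rightarrow> 'x \<times> nat \<Rightarrow> real" where
  "coin_predictor q = (\<lambda>z\<in>{undefined}\<times>{1..2}. if snd z = 1 then 1 / 2 else q)"

lemma space_coin_space:
  "space coin_space = {undefined} \<times> ({1..2} \<rightarrow>\<^sub>E {0..1})"
  by (simp add: coin_space_def space_pair_measure space_PiM coin_context_def space_restrict_space)

lemma coin_draw_in_space: "coin_draw b \<in> space coin_space"
  by (auto simp: space_coin_space coin_draw_def)

lemma measurable_coin_draw [measurable]:
  "coin_draw \<in> measurable (measure_pmf (bernoulli_pmf p)) coin_space"
  using coin_draw_in_space by auto

lemma prob_space_coin_csc: "prob_space (coin_csc p)"
  unfolding coin_csc_def
  by (intro prob_space.prob_space_distr measurable_coin_draw prob_space_measure_pmf)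

lemma sets_coin_csc [measurable_cong]: "sets (coin_csc p) = sets coin_space"
  by (simp add: coin_csc_def)

lemma space_coin_csc: "space (coin_csc p) = {undefined} \<times> ({1..2} \<rightarrow>\<^sub>E {0..1})"
  by (simp add: coin_csc_def space_coin_space)

lemma csc_problem_coin: "csc_problem coin_context 2 (coin_csc p)"
  by (simp only: csc_problem_def prob_space_coin_csc sets_coin_csc coin_space_def)

lemma measurable_cost [measurable]:
  assumes "a \<in> {1..2}"
  shows "(\<lambda>z. snd z a) \<in> borel_measurable coin_space"
proof -
  have "(\<lambda>z. snd z a) \<in> measurable coin_space (restrict_space borel {0..1})"
    unfolding coin_space_def
    by (rule measurable_compose[OF measurable_snd measurable_component_singleton[OF assms]])
  then show ?thesis by (auto simp: measurable_restrict_space2_iff)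
qed

lemma integral_coin_csc:
  fixes g :: "'x \<times> (nat \<Rightarrow> real) \<Rightarrow> real"
  assumes "g \<in> borel_measurable coin_space" "0 \<le> p" "p \<le> 1"
  shows "(\<integral>z. g z \<partial>coin_csc p) = p * g (coin_draw True) + (1 - p) * g (coin_draw False)"
  unfolding coin_csc_def
  by (subst integral_distr[OF measurable_coin_draw assms(1)]) (simp add: assms)

lemma integral_cost_coin_csc:
  assumes "0 \<le> p" "p \<le> 1" "a \<in> {1..2}"
  shows "(\<integral>z. snd z a \<partial>(coin_csc p :: ('x \<times> (nat \<Rightarrow> real)) measure)) = (if a = 1 then 1 / 2 else p)"
  using assms(1,2) measurable_cost[OF assms(3)] assms(3)
  by (subst integral_coin_csc) (auto simp: coin_draw_def field_simps)

lemma function_class_coin: "function_class coin_context 2 {coin_predictor p, coin_predictor q}"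
  if "0 \<le> p" "p \<le> 1" "0 \<le> q" "q \<le> 1"
  using that by (auto simp: function_class_def coin_context_def coin_predictor_def)

lemma coin_predictor_eq_iff: "coin_predictor p = coin_predictor q \<longleftrightarrow> p = q"
proof
  assume "coin_predictor p = (coin_predictor q :: 'x \<times> nat \<Rightarrow> real)"
  then have "coin_predictor p (undefined :: 'x, 2) = coin_predictor q (undefined :: 'x, 2)" by simp
  then show "p = q" by (simp add: coin_predictor_def)
qed simp

text \<open>With a single context, the sigma-algebra generated by the context is trivial, so
  conditional means are plain expectations.\<close>

lemma conditional_mean_cost_coin:
  assumes p: "0 \<le> p" "p \<le> 1"
  shows "conditional_mean_cost coin_context 2 (coin_csc p) (coin_predictor p :: 'x \<times> nat \<Rightarrow> real)"
  unfolding conditional_mean_cost_def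
proof (intro ballI conjI)
  fix a :: nat assume a: "a \<in> {1..2}"
  let ?d = "coin_csc p :: ('x \<times> (nat \<Rightarrow> real)) measure"
  let ?F = "vimage_algebra (space ?d) fst (coin_context :: 'x measure)"
  let ?f = "coin_predictor p :: 'x \<times> nat \<Rightarrow> real"
  show "(\<lambda>x. ?f (x, a)) \<in> borel_measurable coin_context"
    by (simp add: coin_context_def)
  interpret prob_space ?d by (rule prob_space_coin_csc)
  have "fst \<in> measurable ?d (coin_context :: 'x measure)"
    by (simp add: measurable_cong_sets[OF sets_coin_csc refl] coin_space_def)
  then have sub: "subalgebra ?d ?F"
    unfolding subalgebra_def by (simp add: sets_image_in_sets)
  interpret finite_measure_subalgebra ?d ?F
    by unfold_locales (rule sub)
  have F: "B = {} \<or> B = space ?d" if "B \<in> sets ?F" for B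
    using that by (subst (asm) sets_vimage_algebra2) (auto simp: space_coin_csc coin_context_def)
  have m: "(\<lambda>z. snd z a) \<in> borel_measurable ?d"
    using measurable_cost[OF a] by (simp add: measurable_cong_sets[OF sets_coin_csc refl])
  have bd: "AE z in ?d. norm (snd z a) \<le> 1"
    using a by (intro AE_I2) (auto simp: space_coin_csc PiE_iff)
  \<comment> \<open>By \<open>F\<close>, integrals have to be compared only over the empty set,
    where they vanish, and over the whole space, where both equal the mean cost of
    \<open>a\<close>.\<close>
  have "AE z in ?d. real_cond_exp ?d ?F (\<lambda>z. snd z a) z = (\<lambda>_. ?f (undefined, a)) z"
  proof (rule real_cond_exp_charact)
    fix B assume "B \<in> sets ?F"
    then show "(\<integral>z\<in>B. snd z a \<partial>?d) = (\<integral>z\<in>B. ?f (undefined, a) \<partial>?d)"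
      using F[of B] a integral_cost_coin_csc[OF p a]
      by (auto simp: set_lebesgue_integral_def set_integral_space[unfolded set_lebesgue_integral_def]
          indicator_def prob_space coin_predictor_def cong: Bochner_Integration.integral_cong)
  qed (auto intro: integrable_const_bound[OF bd m])
  then show "AE z in ?d. real_cond_exp ?d ?F (\<lambda>z. snd z a) z = ?f (fst z, a)"
    by (rule AE_mp) (auto simp: space_coin_csc intro!: AE_I2)
qed

section \<open>Policies: values, optimality, variance, greediness\<close>

lemma policies_coin: "\<pi> \<in> policies coin_context 2 \<longleftrightarrow> \<pi> undefined \<in> {1..2}"
  by (simp add: policies_def coin_context_def)

lemma policy_value_coin:
  fixes \<pi> :: "'x \<Rightarrow> nat"
  assumes "0 \<le> p" "p \<le> 1" "\<pi> \<in> policies coin_context 2"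
  shows "policy_value (coin_csc p) \<pi> = (if \<pi> undefined = 1 then 1 / 2 else p)"
proof -
  have "policy_value (coin_csc p) \<pi> = (\<integral>z. snd z (\<pi> undefined) \<partial>(coin_csc p :: ('x \<times> (nat \<Rightarrow> real)) measure))"
    unfolding policy_value_def
    by (rule Bochner_Integration.integral_cong) (auto simp: space_coin_csc)
  then show ?thesis
    using assms by (simp only: policies_coin integral_cost_coin_csc)
qed

lemma const_one_mem_policies_coin: "(\<lambda>_. 1) \<in> policies coin_context 2"
  by (auto simp: policies_coin)

lemma optimal_value_coin:
  assumes "1 / 2 \<le> p" "p \<le> 1"
  shows "optimal_value coin_context 2 (coin_csc p :: ('x \<times> (nat \<Rightarrow> real)) measure) = 1 / 2"
  unfolding optimal_value_def
proof (rule cInf_eq_minimum)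
  have "policy_value (coin_csc p :: ('x \<times> (nat \<Rightarrow> real)) measure) (\<lambda>_. 1) = 1 / 2"
    using assms const_one_mem_policies_coin by (subst policy_value_coin) auto
  then show "1 / 2 \<in> policy_value (coin_csc p :: ('x \<times> (nat \<Rightarrow> real)) measure) ` policies coin_context 2"
    using const_one_mem_policies_coin by (metis imageI)
qed (use assms in \<open>auto simp: policy_value_coin\<close>)

text \<open>As \<open>p\<close> exceeds 1/2 strictly, only action 1 attains the minimum; values of a
  policy off the single context do not matter.\<close>

lemma optimal_policy_coin:
  fixes \<pi> :: "'x \<Rightarrow> nat"
  assumes "1 / 2 < p" "p \<le> 1"
  shows "optimal_policy coin_context 2 (coin_csc p) \<pi> \<longleftrightarrow> \<pi> undefined = 1"
proof -
  have opt: "optimal_policy coin_context 2 (coin_csc p) \<pi> \<longleftrightarrow> \<pi> \<in> policies coin_context 2 \<and>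
      (\<forall>\<pi>'\<in>policies (coin_context :: 'x measure) 2. policy_value (coin_csc p) \<pi> \<le> policy_value (coin_csc p) \<pi>')"
    by (simp add: optimal_policy_def is_arg_min_linorder Ball_def)
  show ?thesis
  proof
    assume "optimal_policy coin_context 2 (coin_csc p) \<pi>"
    then have "\<pi> \<in> policies coin_context 2"
      and "policy_value (coin_csc p) \<pi> \<le> policy_value (coin_csc p) (\<lambda>_ :: 'x. 1)"
      unfolding opt by (auto intro: bspec[OF _ const_one_mem_policies_coin] simp del: One_nat_def)
    with assms show "\<pi> undefined = 1"
      by (simp add: policy_value_coin policies_coin split: if_splits)
  next
    assume "\<pi> undefined = 1"
    with assms show "optimal_policy coin_context 2 (coin_csc p) \<pi>"
      by (simp add: opt policy_value_coin policies_coin)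
  qed
qed

lemma policy_variance_coin:
  fixes \<pi> :: "'x \<Rightarrow> nat"
  assumes "0 \<le> p" "p \<le> 1" "\<pi> undefined = 1"
  shows "policy_variance (coin_csc p) \<pi> = 0"
proof -
  have \<pi>: "\<pi> \<in> policies coin_context 2" using assms(3) by (simp add: policies_coin)
  have "policy_variance (coin_csc p) \<pi> = (\<integral>z. (snd z 1 - 1 / 2)\<^sup>2 \<partial>(coin_csc p :: ('x \<times> (nat \<Rightarrow> real)) measure))"
    unfolding policy_variance_def
    by (rule Bochner_Integration.integral_cong)
       (auto simp: space_coin_csc assms policy_value_coin[OF assms(1,2) \<pi>])
  also have "\<dots> = 0"
    using measurable_cost[of 1] assms(1,2)
    by (subst integral_coin_csc) (auto simp: coin_draw_def)
  finally show ?thesis .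
qed

text \<open>The predictor compares 1/2 with \<open>q\<close>; excluding a tie makes all greedy
  policies take the same action.\<close>

lemma greedy_policy_coin:
  fixes \<pi> :: "'x \<Rightarrow> nat"
  assumes g: "greedy_policy coin_context 2 (coin_predictor q) \<pi>" and q: "q \<noteq> 1 / 2"
  shows "\<pi> undefined = (if q < 1 / 2 then 2 else 1)"
proof -
  from g have \<pi>: "\<pi> undefined \<in> {1..2}" by (simp add: greedy_policy_def policies_coin)
  have "\<not> coin_predictor q (undefined :: 'x, a) < coin_predictor q (undefined :: 'x, \<pi> undefined)" if "a \<in> {1..2}" for a
    using g that unfolding greedy_policy_def is_arg_min_def coin_context_def
    by (metis space_count_space singletonI)
  from this[of 1] this[of 2] \<pi> q show ?thesis
    by (auto simp: coin_predictor_def split: if_splits)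
qed

section \<open>Cross-entropy risk and its minimizers\<close>

text \<open>At the prediction 1/2 both logarithms agree, so action 1 adds \<open>ln 2\<close>
  whatever its cost and cannot influence the choice between predictors. With \<open>q\<close>
  strictly between 0 and 1 all losses are finite, which brings the risk from \<open>ereal\<close>
  back to the reals.\<close>

lemma bce_risk_coin_predictor:
  assumes q: "0 < q" "q < 1" and S: "\<And>i. i \<in> {1..n} \<Longrightarrow> fst (S i) = undefined"
  shows "bce_risk 2 n S (coin_predictor q) =
    ereal (\<Sum>i=1..n. ln 2 - snd (S i) 2 * ln q - (1 - snd (S i) 2) * ln (1 - q))"
proof -
  have loss: "bce_loss r y = ereal (- y * ln r - (1 - y) * ln (1 - r))" if "0 < r" "r < 1" for r y :: real
    using that by (simp add: bce_loss_def neg_ln_def)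
  have half: "bce_loss (1 / 2) y = ereal (ln 2)" for y :: real
    by (subst loss) (auto simp: ln_div algebra_simps)
  have "{1..2} = {1, 2 :: nat}" by auto
  then have "(\<Sum>a=1..2. bce_loss (coin_predictor q (fst (S i), a)) (snd (S i) a)) =
      ereal (ln 2 - snd (S i) 2 * ln q - (1 - snd (S i) 2) * ln (1 - q))" if "i \<in> {1..n}" for i
    using S[OF that] by (simp add: coin_predictor_def half loss[OF q] One_nat_def[symmetric] del: One_nat_def)
  then show ?thesis unfolding bce_risk_def sum_ereal[symmetric] by (intro sum.cong refl)
qed

text \<open>The two risks differ by the positive log odds of \<open>p\<close> times
  \<open>2 * s - real n\<close>, whose sign decides. The costs in \<open>S\<close> are arbitrary
  reals here, so ties can occur.\<close>

lemma bce_minimizer_coin: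
  assumes p: "1 / 2 < p" "p < 1" and S: "\<And>i. i \<in> {1..n} \<Longrightarrow> fst (S i) = undefined"
  shows "bce_minimizer 2 n {coin_predictor p, coin_predictor (1 - p)} S f \<longleftrightarrow>
    f = coin_predictor p \<and> real n \<le> 2 * (\<Sum>i=1..n. snd (S i) 2) \<or>
    f = coin_predictor (1 - p) \<and> 2 * (\<Sum>i=1..n. snd (S i) 2) \<le> real n"
proof -
  define s where "s = (\<Sum>i=1..n. snd (S i) 2)"
  define r where "r = (\<Sum>i=1..n. ln 2 - snd (S i) 2 * ln p - (1 - snd (S i) 2) * ln (1 - p))"
  define r' where "r' = (\<Sum>i=1..n. ln 2 - snd (S i) 2 * ln (1 - p) - (1 - snd (S i) 2) * ln p)"
  have "r' - r = (\<Sum>i=1..n. (ln p - ln (1 - p)) * (2 * snd (S i) 2 - 1))"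
    unfolding r_def r'_def sum_subtractf[symmetric] by (intro sum.cong) (auto simp: algebra_simps)
  also have "\<dots> = (ln p - ln (1 - p)) * (2 * s - real n)"
    by (simp add: s_def sum_subtractf sum_distrib_left[symmetric])
  finally have diff: "r' - r = (ln p - ln (1 - p)) * (2 * s - real n)" .
  have pos: "0 < ln p - ln (1 - p)" using p by simp
  have "0 < r' - r \<longleftrightarrow> real n < 2 * s" "r' - r < 0 \<longleftrightarrow> 2 * s < real n"
    using pos unfolding diff zero_less_mult_iff mult_less_0_iff by auto
  then have cmp: "r \<le> r' \<longleftrightarrow> real n \<le> 2 * s" "r' \<le> r \<longleftrightarrow> 2 * s \<le> real n" by linarith+
  have "bce_risk 2 n S (coin_predictor p) = ereal r"
    "bce_risk 2 n S (coin_predictor (1 - p)) = ereal r'"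
    using p S unfolding r_def r'_def by (subst bce_risk_coin_predictor; simp)+
  then have "bce_minimizer 2 n {coin_predictor p, coin_predictor (1 - p)} S f \<longleftrightarrow>
      f = coin_predictor p \<and> r \<le> r' \<or> f = coin_predictor (1 - p) \<and> r' \<le> r"
    unfolding bce_minimizer_def is_arg_min_def by (metis empty_iff ereal_less_eq(3) insert_iff not_less order_refl)
  then show ?thesis unfolding cmp s_def .
qed

section \<open>The law of the sampled cost sum\<close>

text \<open>The sample is the image of \<open>n\<close> independent flips, the cost sum of action 2
  is the number of \<open>True\<close> flips, and such a count is binomial.\<close>

lemma prob_cost_sum_less_half:
  assumes p: "0 \<le> p" "p \<le> 1" and n: "n = 2 * m + 1"
  shows "measure (iid_sample n (coin_csc p))
      {S \<in> space (iid_sample n (coin_csc p)). 2 * (\<Sum>i=1..n. snd (S i) 2) < real n}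
    = measure_pmf.prob (binomial_pmf n p) {..m}" (is "measure ?I ?E = _")
proof -
  have I: "?I = distr (measure_pmf (Pi_pmf {1..n} False (\<lambda>_. bernoulli_pmf p)))
      (\<Pi>\<^sub>M i\<in>{1..n}. coin_space) (\<lambda>b. \<lambda>i\<in>{1..n}. coin_draw (b i))" (is "_ = distr ?P ?M ?g")
    unfolding iid_sample_def coin_csc_def
    by (rule PiM_distr_measure_pmf) (auto intro: coin_draw_in_space)
  have g: "?g \<in> measurable ?P ?M"
    by (auto simp: space_PiM coin_draw_in_space)
  have c: "(\<lambda>S. snd (S i) 2) \<in> borel_measurable ?M" if "i \<in> {1..n}" for i
    by (rule measurable_compose[OF measurable_component_singleton[OF that] measurable_cost]) simp
  have "(\<lambda>S. 2 * (\<Sum>i=1..n. snd (S i) 2)) \<in> borel_measurable ?M"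
    by (intro borel_measurable_times borel_measurable_sum c) auto
  then have E: "?E \<in> sets ?M"
    unfolding I by simp
  have sum: "(\<Sum>i=1..n. snd (?g b i) 2) = real (card {i\<in>{1..n}. b i})" for b :: "nat \<Rightarrow> bool"
  proof -
    have "(\<Sum>i=1..n. snd (?g b i) 2) = (\<Sum>i=1..n. of_bool (b i))"
      by (intro sum.cong) (auto simp: coin_draw_def)
    then show ?thesis by (simp add: Int_def)
  qed
  have "measure ?I ?E = measure ?P (?g -` ?E)"
    by (subst I, subst measure_distr[OF g E]) simp
  also have "?g -` ?E = (\<lambda>b. card {i\<in>{1..n}. b i}) -` {..m}"
  proof (rule set_eqI)
    fix b
    have "b \<in> ?g -` ?E \<longleftrightarrow> 2 * real (card {i\<in>{1..n}. b i}) < real n"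
      using measurable_space[OF g, of b] unfolding I by (simp only: vimage_eq mem_Collect_eq sum) simp
    \<comment> \<open>For an integer count, being below \<open>n / 2 = m + 1 / 2\<close> means being
      at most \<open>m\<close>.\<close>
    also have "\<dots> \<longleftrightarrow> card {i\<in>{1..n}. b i} \<le> m" unfolding n by linarith
    finally show "b \<in> ?g -` ?E \<longleftrightarrow> b \<in> (\<lambda>b. card {i\<in>{1..n}. b i}) -` {..m}"
      by (simp only: vimage_eq atMost_iff)
  qed
  also have "measure ?P \<dots> = measure_pmf.prob (binomial_pmf n p) {..m}"
    using p by (subst binomial_pmf_altdef'[where A = "{1..n}" and dflt = False]) auto
  finally show ?thesis .
qed

section \<open>Excess cost of the greedy policy\<close>

theorem theorem6:
  fixes n :: nat
  assumes "odd n"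
  shows "\<exists>(X :: 'x measure) (d :: ('x \<times> (nat \<Rightarrow> real)) measure) (F :: ('x \<times> nat \<Rightarrow> real) set).
    csc_problem X 2 d \<and>
    card (space X) = 1 \<and>
    function_class X 2 F \<and>
    card F = 2 \<and>
    realizable X 2 d F \<and>
    (\<exists>\<pi>. optimal_policy X 2 d \<pi>) \<and>
    (\<forall>\<pi>. optimal_policy X 2 d \<pi> \<longrightarrow> policy_variance d \<pi> = 0) \<and>
    measure (iid_sample n d)
      {S \<in> space (iid_sample n d).
         \<forall>f \<pi>. bce_minimizer 2 n F S f \<and> greedy_policy X 2 f \<pi> \<longrightarrow>
           policy_value d \<pi> - optimal_value X 2 d \<ge> 1 / (8 * sqrt (real n))} \<ge> 1 / 4"
proof -
  obtain m where n: "n = 2 * m + 1" using assms by (auto elim: oddE)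
  define e where "e = 1 / (8 * sqrt (real n))"
  define p where "p = 1 / 2 + e"
  have "1 \<le> sqrt (real n)" using n by simp
  then have e: "0 < e" "e \<le> 1 / 8" by (auto simp: e_def field_simps)
  then have p: "1 / 2 < p" "p < 1" by (auto simp: p_def)
  let ?X = "coin_context :: 'x measure"
  let ?d = "coin_csc p :: ('x \<times> (nat \<Rightarrow> real)) measure"
  let ?F = "{coin_predictor p, coin_predictor (1 - p)} :: ('x \<times> nat \<Rightarrow> real) set"
  \<comment> \<open>The excess cost is 0 for action 1 and exactly \<open>p - 1 / 2 = e\<close> for
    action 2.\<close>
  have gap: "e \<le> policy_value ?d \<pi> - optimal_value ?X 2 ?d \<longleftrightarrow> \<pi> undefined = 2"
    if "\<pi> \<in> policies ?X 2" for \<pi>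
    using that e p by (auto simp: policy_value_coin optimal_value_coin p_def policies_coin)
  \<comment> \<open>Without a greedy policy for the true predictor, the claim quantified over all
    \<open>\<pi>\<close> would hold vacuously for that predictor.\<close>
  have ex: "greedy_policy ?X 2 (coin_predictor p) (\<lambda>_. 1)"
    using p const_one_mem_policies_coin
    by (auto simp: greedy_policy_def is_arg_min_def coin_predictor_def coin_context_def simp del: One_nat_def)
  \<comment> \<open>The equivalence holds on the whole sample space, which also contains costs
    strictly between 0 and 1 and hence ties. In a tie the true predictor is a minimizer too, and
    both sides are false.\<close>
  have "(\<forall>f \<pi>. bce_minimizer 2 n ?F S f \<and> greedy_policy ?X 2 f \<pi> \<longrightarrow>
        e \<le> policy_value ?d \<pi> - optimal_value ?X 2 ?d) \<longleftrightarrow> 2 * (\<Sum>i=1..n. snd (S i) 2) < real n" (is "?L \<longleftrightarrow> ?R")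
    if "S \<in> space (iid_sample n ?d)" for S
  proof -
    have "fst (S i) = undefined" if "i \<in> {1..n}" for i
    proof -
      have "S i \<in> space ?d"
        using \<open>S \<in> _\<close> that unfolding iid_sample_def space_PiM by (rule PiE_mem)
      then show ?thesis by (auto simp: space_coin_csc)
    qed
    note min = bce_minimizer_coin[OF p this]
    show ?thesis
    proof
      assume L: ?L
      have "\<not> bce_minimizer 2 n ?F S (coin_predictor p)"
        using L ex gap[OF const_one_mem_policies_coin] by fastforce
      then show ?R using min by auto
    next
      assume R: ?R
      show ?L
      proof (intro allI impI, elim conjE)
        fix f \<pi> assume "bce_minimizer 2 n ?F S f" and g: "greedy_policy ?X 2 f \<pi>"
        then have "f = coin_predictor (1 - p)" using R min by auto
        then have "\<pi> undefined = 2" using g greedy_policy_coin[of "1 - p" \<pi>] p by simp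
        then show "e \<le> policy_value ?d \<pi> - optimal_value ?X 2 ?d"
          using g gap by (simp add: greedy_policy_def)
      qed
    qed
  qed
  then have "{S \<in> space (iid_sample n ?d).
         \<forall>f \<pi>. bce_minimizer 2 n ?F S f \<and> greedy_policy ?X 2 f \<pi> \<longrightarrow>
           e \<le> policy_value ?d \<pi> - optimal_value ?X 2 ?d}
    = {S \<in> space (iid_sample n ?d). 2 * (\<Sum>i=1..n. snd (S i) 2) < real n}"
    by blast
  moreover have "1 / 4 \<le> measure_pmf.prob (binomial_pmf n p) {..m}"
    using binomial_pmf_lower_half_ge[OF n] unfolding p_def e_def by linarith
  ultimately have prob: "1 / 4 \<le> measure (iid_sample n ?d)
      {S \<in> space (iid_sample n ?d).
         \<forall>f \<pi>. bce_minimizer 2 n ?F S f \<and> greedy_policy ?X 2 f \<pi> \<longrightarrow>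
           e \<le> policy_value ?d \<pi> - optimal_value ?X 2 ?d}"
    using p by (simp only: prob_cost_sum_less_half[OF _ _ n])
  show ?thesis
  proof (intro exI conjI)
    show "csc_problem ?X 2 ?d" by (rule csc_problem_coin)
    show "card (space ?X) = 1" by (simp add: coin_context_def)
    show "function_class ?X 2 ?F" using p by (intro function_class_coin) auto
    show "card ?F = 2" using p by (simp add: card_insert_if coin_predictor_eq_iff)
    show "realizable ?X 2 ?d ?F"
      using conditional_mean_cost_coin[of p] p by (auto simp: realizable_def)
    show "optimal_policy ?X 2 ?d (\<lambda>_. 1)" using p by (simp add: optimal_policy_coin)
    show "\<forall>\<pi>. optimal_policy ?X 2 ?d \<pi> \<longrightarrow> policy_variance ?d \<pi> = 0"
      using p by (simp add: optimal_policy_coin policy_variance_coin)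
  qed (rule prob[unfolded e_def])
qed

end
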